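(* Let $\alpha,\beta>0$, $x_1,x_2\in\mathbb{R}$, and let $B=B_{\alpha,\beta}(t,x;x_1,x_2)$ be any 5th, 7th or 9th order mKdV breather (i.e. the function defined in the context with $i=5$, $i=7$ or $i=9$). Then, for any fixed $t\in\mathbb{R}$, $B$ satisfies (as a function of $x\in\mathbb{R}$) the following fourth order stationary equation, which is the same one as that satisfied by the classical mKdV breather: $$B_{4x}+10BB_x^2+10B^2B_{xx}+6B^5-2(\beta^2-\alpha^2)(B_{xx}+2B^3)+(\alpha^2+\beta^2)^2B=0.$$
   Context: Subscripts $x$ denote partial derivatives in $x$; $B_{kx}=\partial_x^kB$. For $i\in\{5,7,9\}$, the $i$-th order mKdV breather with parameters $\alpha,\beta>0$, $x_1,x_2\in\mathbb{R}$ is the real-valued function $$B_{\alpha,\beta}(t,x;x_1,x_2):=2\,\partial_x\left[\arctan\left(\frac{\beta}{\alpha}\frac{\sin(\alpha y_1)}{\cosh(\beta y_2)}\right)\right],\qquad y_1=x+\delta_it+x_1,\quad y_2=x+\gamma_it+x_2,$$ with velocities $\delta_5=-\alpha^4+10\alpha^2\beta^2-5\beta^4$, $\gamma_5=-\beta^4+10\alpha^2\beta^2-5\alpha^4$; $\delta_7=\alpha^6-21\alpha^4\beta^2+35\alpha^2\beta^4-7\beta^6$, $\gamma_7=-\beta^6+21\alpha^2\beta^4-35\alpha^4\beta^2+7\alpha^6$; $\delta_9=-\alpha^8+36\alpha^6\beta^2-126\alpha^4\beta^4+84\alpha^2\beta^6-9\beta^8$, $\gamma_9=-\beta^8+36\alpha^2\beta^6-126\alpha^4\beta^4+84\alpha^6\beta^2-9\alpha^8$.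 The classical mKdV breather is given by the same formula with velocities $\delta=\alpha^2-3\beta^2$, $\gamma=3\alpha^2-\beta^2$. *)

theory Defs
  imports "HOL-Analysis.Analysis"
begin

datatype mkdv_order = Classical | Fifth | Seventh | Ninth

primrec mkdv_delta :: "mkdv_order \<Rightarrow> real \<Rightarrow> real \<Rightarrow> real" where
  "mkdv_delta Classical a b = a^2 - 3 * b^2"
| "mkdv_delta Fifth a b = - (a^4) + 10 * a^2 * b^2 - 5 * b^4"
| "mkdv_delta Seventh a b = a^6 - 21 * a^4 * b^2 + 35 * a^2 * b^4 - 7 * b^6"
| "mkdv_delta Ninth a b =
     - (a^8) + 36 * a^6 * b^2 - 126 * a^4 * b^4 + 84 * a^2 * b^6 - 9 * b^8"

primrec mkdv_gamma :: "mkdv_order \<Rightarrow> real \<Rightarrow> real \<Rightarrow> real" where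
  "mkdv_gamma Classical a b = 3 * a^2 - b^2"
| "mkdv_gamma Fifth a b = - (b^4) + 10 * a^2 * b^2 - 5 * a^4"
| "mkdv_gamma Seventh a b = - (b^6) + 21 * a^2 * b^4 - 35 * a^4 * b^2 + 7 * a^6"
| "mkdv_gamma Ninth a b =
     - (b^8) + 36 * a^2 * b^6 - 126 * a^4 * b^4 + 84 * a^6 * b^2 - 9 * a^8"

definition mkdv_breather ::
  "mkdv_order \<Rightarrow> real \<Rightarrow> real \<Rightarrow> real \<Rightarrow> real \<Rightarrow> real \<Rightarrow> real \<Rightarrow> real" where
  "mkdv_breather i \<alpha> \<beta> x1 x2 t x =
     2 * deriv (\<lambda>z. arctan ((\<beta> / \<alpha>) *
           (sin (\<alpha> * (z + mkdv_delta i \<alpha> \<beta> * t + x1))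
            / cosh (\<beta> * (z + mkdv_gamma i \<alpha> \<beta> * t + x2))))) x"

(* deriv is a total operator with an unspecified value at points of
   non-differentiability, so a (classical) solution is also required to have
   the four derivatives that occur in the equation. *)
definition solves_breather_equation :: "real \<Rightarrow> real \<Rightarrow> (real \<Rightarrow> real) \<Rightarrow> bool" where
  "solves_breather_equation \<alpha> \<beta> B \<longleftrightarrow>
     (\<forall>k<4. \<forall>x. ((deriv ^^ k) B) differentiable (at x)) \<and>
     (\<forall>x. (deriv ^^ 4) B x + 10 * B x * (deriv B x)^2 + 10 * (B x)^2 * (deriv ^^ 2) B x
          + 6 * (B x)^5 - 2 * (\<beta>^2 - \<alpha>^2) * ((deriv ^^ 2) B x + 2 * (B x)^3)
          + (\<alpha>^2 + \<beta>^2)^2 * B x = 0)"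

end

theory Submission
  imports Defs
begin

text \<open>
  Write the breather as \<open>B = 2 \<partial>\<^sub>x arctan (G / F)\<close> with
  \<open>F'' = \<beta>\<^sup>2 F\<close>, \<open>G'' = - \<alpha>\<^sup>2 G\<close> and \<open>F'\<^sup>2 + G'\<^sup>2 = \<beta>\<^sup>2 F\<^sup>2 - \<alpha>\<^sup>2 G\<^sup>2\<close>; the velocities
  only shift the phases and play no role. With \<open>\<phi> = F + i G\<close>, set
  \<open>u + i B = 2 \<phi>' / \<phi>\<close> and \<open>\<kappa> + i \<sigma> = \<phi> / cnj \<phi>\<close>. These four functions
  form a closed first order system with the two first integrals
  \<open>\<kappa>\<^sup>2 + \<sigma>\<^sup>2 = 1\<close> and \<open>B\<^sup>2 + u\<^sup>2 = 2 (\<beta>\<^sup>2 - \<alpha>\<^sup>2) + 2 (\<alpha>\<^sup>2 + \<beta>\<^sup>2) \<kappa>\<close>, from which the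
  fourth order equation follows by differentiating \<open>B\<close>.
\<close>

lemma solves_breather_equation_if_derivatives:
  fixes B :: "real \<Rightarrow> real"
  assumes d0: "\<And>x. (B has_field_derivative B1 x) (at x)"
    and d1: "\<And>x. (B1 has_field_derivative B2 x) (at x)"
    and d2: "\<And>x. (B2 has_field_derivative B3 x) (at x)"
    and d3: "\<And>x. (B3 has_field_derivative B4 x) (at x)"
    and eq: "\<And>x. B4 x + 10 * B x * (B1 x)^2 + 10 * (B x)^2 * B2 x + 6 * (B x)^5
      - 2 * (\<beta>^2 - \<alpha>^2) * (B2 x + 2 * (B x)^3) + (\<alpha>^2 + \<beta>^2)^2 * B x = 0"
  shows "solves_breather_equation \<alpha> \<beta> B"
proof -
  have e: "deriv B = B1" "deriv B1 = B2" "deriv B2 = B3" "deriv B3 = B4"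
    using d0 d1 d2 d3 by (auto intro!: ext DERIV_imp_deriv)
  have p: "(deriv ^^ 0) B = B" "(deriv ^^ 1) B = B1" "(deriv ^^ 2) B = B2"
    "(deriv ^^ 3) B = B3" "(deriv ^^ 4) B = B4"
    by (simp_all add: e eval_nat_numeral)
  have "(deriv ^^ k) B differentiable (at x)" if "k < 4" for k x
  proof -
    have "k = 0 \<or> k = 1 \<or> k = 2 \<or> k = 3"
      using that by linarith
    then show ?thesis
      using d0 d1 d2 d3 p real_differentiable_def by metis
  qed
  then show ?thesis
    unfolding solves_breather_equation_def using eq by (simp add: e(1) p)
qed

text \<open>Since the system is closed, all derivatives of \<open>B\<close> are polynomials in
  \<open>B\<close>, \<open>u\<close>, \<open>\<kappa>\<close>, \<open>\<sigma>\<close>, and the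
  equation becomes an algebraic identity modulo \<open>unit\<close> and
  \<open>energy\<close>.\<close>

lemma solves_breather_equation_if_system:
  fixes \<alpha> \<beta> :: real and B u \<kappa> \<sigma> :: "real \<Rightarrow> real"
  defines "m \<equiv> \<alpha>^2 + \<beta>^2" and "a \<equiv> 2 * (\<beta>^2 - \<alpha>^2)"
  assumes dB: "\<And>x. (B has_field_derivative - m * \<sigma> x - u x * B x) (at x)"
    and du: "\<And>x. (u has_field_derivative (B x)^2) (at x)"
    and d\<kappa>: "\<And>x. (\<kappa> has_field_derivative - B x * \<sigma> x) (at x)"
    and d\<sigma>: "\<And>x. (\<sigma> has_field_derivative B x * \<kappa> x) (at x)"
    and unit: "\<And>x. (\<kappa> x)^2 + (\<sigma> x)^2 = 1"
    and energy: "\<And>x. (B x)^2 + (u x)^2 = a + 2 * m * \<kappa> x"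
  shows "solves_breather_equation \<alpha> \<beta> B"
proof -
  define B1 where "B1 = (\<lambda>x. - m * \<sigma> x - u x * B x)"
  \<comment> \<open>The derivative of \<open>B1\<close> with \<open>u^2\<close> eliminated by
    \<open>energy\<close>. In its own derivative the terms \<open>m B^2 \<sigma>\<close> cancel, and
    \<open>B1 + u B = - m \<sigma>\<close> absorbs \<open>u\<close> into \<open>B1\<close>, which
    gives \<open>B3\<close>.\<close>
  define B2 where "B2 = (\<lambda>x. m * \<kappa> x * B x + a * B x - 2 * (B x)^3 + m * u x * \<sigma> x)"
  define B3 where "B3 = (\<lambda>x. - (m^2) * \<kappa> x * \<sigma> x + (a - 6 * (B x)^2) * B1 x)"
  define B4 where "B4 = (\<lambda>x. m^2 * B x * ((\<sigma> x)^2 - (\<kappa> x)^2) + (a - 6 * (B x)^2) * B2 x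
    - 12 * B x * (B1 x)^2)"
  have D0: "(B has_field_derivative B1 x) (at x)" for x
    using dB[of x] by (simp add: B1_def)
  have D1: "(B1 has_field_derivative B2 x) (at x)" for x
  proof -
    have u2: "(u x)^2 = a + 2 * m * \<kappa> x - (B x)^2"
      using energy[of x] by linarith
    have "(B1 has_field_derivative - m * (B x * \<kappa> x) - ((B x)^2 * B x + B1 x * u x)) (at x)"
      unfolding B1_def by (rule derivative_eq_intros dB du d\<kappa> d\<sigma> refl | simp)+
    moreover have "- m * (B x * \<kappa> x) - ((B x)^2 * B x + B1 x * u x)
        = - m * \<kappa> x * B x - (B x)^3 + m * u x * \<sigma> x + (u x)^2 * B x"
      by (simp add: B1_def algebra_simps power2_eq_square power3_eq_cube)
    moreover have "\<dots> = B2 x"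
      unfolding u2 by (simp add: B2_def algebra_simps power2_eq_square power3_eq_cube)
    ultimately show ?thesis
      by (simp only:)
  qed
  have D2: "(B2 has_field_derivative B3 x) (at x)" for x
    unfolding B2_def
    by (rule derivative_eq_intros D0 du d\<kappa> d\<sigma> refl)+
      (simp add: B3_def B1_def algebra_simps power2_eq_square power3_eq_cube)
  have D3: "(B3 has_field_derivative B4 x) (at x)" for x
    unfolding B3_def
    by (rule derivative_eq_intros D0 D1 du d\<kappa> d\<sigma> refl)+
      (simp add: B4_def algebra_simps power2_eq_square power3_eq_cube)
  have "B4 x + 10 * B x * (B1 x)^2 + 10 * (B x)^2 * B2 x + 6 * (B x)^5
      - a * (B2 x + 2 * (B x)^3) + m^2 * B x = 0" for x
  proof -
    \<comment> \<open>The left side is a combination of the defects of the two first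
      integrals.\<close>
    have "B4 x + 10 * B x * (B1 x)^2 + 10 * (B x)^2 * B2 x + 6 * (B x)^5
      - a * (B2 x + 2 * (B x)^3) + m^2 * B x
      = m^2 * B x * (1 - ((\<kappa> x)^2 + (\<sigma> x)^2))
        + 2 * (B x)^3 * (a + 2 * m * \<kappa> x - ((B x)^2 + (u x)^2))"
      unfolding B4_def B1_def B2_def by algebra
    then show ?thesis
      by (simp add: unit energy)
  qed
  then show ?thesis
    using solves_breather_equation_if_derivatives[of B B1 B2 B3 B4, OF D0 D1 D2 D3]
    by (simp add: m_def a_def)
qed

text \<open>The linear equations for \<open>F\<close> and \<open>G\<close> yield the evolution of
  \<open>B\<close>; the constraint \<open>PQ\<close> is what yields \<open>u' = B^2\<close> and the
  energy integral.\<close>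

lemma solves_breather_equation_bilinear:
  fixes F G P Q :: "real \<Rightarrow> real"
  assumes dF: "\<And>x. (F has_field_derivative P x) (at x)"
    and dP: "\<And>x. (P has_field_derivative \<beta>^2 * F x) (at x)"
    and dG: "\<And>x. (G has_field_derivative Q x) (at x)"
    and dQ: "\<And>x. (Q has_field_derivative - (\<alpha>^2) * G x) (at x)"
    and PQ: "\<And>x. (P x)^2 + (Q x)^2 = \<beta>^2 * (F x)^2 - \<alpha>^2 * (G x)^2"
    and F0: "\<And>x. F x \<noteq> 0"
  shows "solves_breather_equation \<alpha> \<beta> (\<lambda>x. 2 * deriv (\<lambda>z. arctan (G z / F z)) x)"
proof -
  \<comment> \<open>\<open>D\<close> is \<open>|\<phi>|^2\<close>, the common denominator of
    \<open>2 \<phi>' / \<phi>\<close> and \<open>\<phi> / cnj \<phi>\<close>.\<close>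
  define D where "D = (\<lambda>x. (F x)^2 + (G x)^2)"
  define B where "B = (\<lambda>x. 2 * (Q x * F x - G x * P x) / D x)"
  define u where "u = (\<lambda>x. 2 * (F x * P x + G x * Q x) / D x)"
  define \<kappa> where "\<kappa> = (\<lambda>x. ((F x)^2 - (G x)^2) / D x)"
  define \<sigma> where "\<sigma> = (\<lambda>x. 2 * F x * G x / D x)"
  have D0: "D x \<noteq> 0" for x
    using F0[of x] by (simp add: D_def sum_power2_eq_zero_iff)
  have dD: "(D has_field_derivative 2 * (F x * P x + G x * Q x)) (at x)" for x
    unfolding D_def by (rule derivative_eq_intros dF dG refl)+ (simp add: algebra_simps)
  have breather: "2 * deriv (\<lambda>z. arctan (G z / F z)) x = B x" for x
  proof -
    have "((\<lambda>z. arctan (G z / F z)) has_field_derivative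
        inverse (1 + (G x / F x)^2) * ((Q x * F x - G x * P x) / (F x * F x))) (at x)"
      by (rule derivative_eq_intros dF dG refl F0)+
    then have "deriv (\<lambda>z. arctan (G z / F z)) x
        = inverse (1 + (G x / F x)^2) * ((Q x * F x - G x * P x) / (F x * F x))"
      by (rule DERIV_imp_deriv)
    also have "1 + (G x / F x)^2 = D x / (F x * F x)"
      using F0[of x] by (simp add: D_def field_simps power2_eq_square)
    finally show ?thesis
      using F0[of x] by (simp add: B_def)
  qed
  \<comment> \<open>The products \<open>P Q\<close> cancel in the derivative of
    \<open>Q F - G P\<close>, leaving \<open>- (\<alpha>^2 + \<beta>^2) F G\<close>; the denominator
    contributes \<open>- u B\<close> because \<open>D' = u D\<close>.\<close>
  have dB: "(B has_field_derivative - (\<alpha>^2 + \<beta>^2) * \<sigma> x - u x * B x) (at x)" for x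
    unfolding B_def
    by (rule derivative_eq_intros dF dG dP dQ dD refl D0)+
      (use D0[of x] in \<open>simp add: \<sigma>_def u_def field_simps power2_eq_square\<close>)
  have du: "(u has_field_derivative (B x)^2) (at x)" for x
  proof -
    have "(u has_field_derivative (2 * (((P x)^2 + (Q x)^2) + (\<beta>^2 * (F x)^2 - \<alpha>^2 * (G x)^2)) * D x
        - (2 * (F x * P x + G x * Q x))^2) / (D x)^2) (at x)"
      unfolding u_def
      by (rule derivative_eq_intros dF dG dP dQ dD refl D0)+
        (simp add: algebra_simps power2_eq_square)
    \<comment> \<open>By \<open>PQ\<close> both summands equal \<open>|\<phi>'|^2\<close>; what
      remains is Lagrange's identity for \<open>(F, G)\<close> and \<open>(P, Q)\<close>.\<close>
    also have "2 * (((P x)^2 + (Q x)^2) + (\<beta>^2 * (F x)^2 - \<alpha>^2 * (G x)^2)) * D x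
        - (2 * (F x * P x + G x * Q x))^2 = (2 * (Q x * F x - G x * P x))^2"
      unfolding PQ[symmetric] D_def by algebra
    finally show ?thesis
      by (simp add: B_def power_divide)
  qed
  \<comment> \<open>The phase of \<open>\<kappa> + i \<sigma>\<close> is
    \<open>2 arctan (G / F)\<close> modulo \<open>2 \<pi>\<close>, so this point rotates with
    angular speed \<open>B\<close>.\<close>
  have d\<kappa>: "(\<kappa> has_field_derivative - B x * \<sigma> x) (at x)" for x
    unfolding \<kappa>_def
    by (rule derivative_eq_intros dF dG dD refl D0)+
      (simp add: B_def \<sigma>_def D_def divide_simps, simp add: algebra_simps power2_eq_square)
  have d\<sigma>: "(\<sigma> has_field_derivative B x * \<kappa> x) (at x)" for x
    unfolding \<sigma>_def
    by (rule derivative_eq_intros dF dG dD refl D0)+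
      (simp add: B_def \<kappa>_def D_def divide_simps, simp add: algebra_simps power2_eq_square)
  have unit: "(\<kappa> x)^2 + (\<sigma> x)^2 = 1" for x
  proof -
    have "((F x)^2 - (G x)^2)^2 + (2 * F x * G x)^2 = (D x)^2"
      unfolding D_def by algebra
    then show ?thesis
      using D0[of x] by (simp add: \<kappa>_def \<sigma>_def power_divide flip: add_divide_distrib)
  qed
  have energy: "(B x)^2 + (u x)^2 = 2 * (\<beta>^2 - \<alpha>^2) + 2 * (\<alpha>^2 + \<beta>^2) * \<kappa> x" for x
  proof -
    \<comment> \<open>Lagrange's identity again:
      \<open>|u + i B|^2 = 4 |\<phi>'|^2 / |\<phi>|^2\<close>.\<close>
    have "(2 * (Q x * F x - G x * P x))^2 + (2 * (F x * P x + G x * Q x))^2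
        = 4 * ((P x)^2 + (Q x)^2) * D x"
      unfolding D_def by algebra
    then have "(B x)^2 + (u x)^2 = 4 * (\<beta>^2 * (F x)^2 - \<alpha>^2 * (G x)^2) / D x"
      using D0[of x] PQ[of x]
      by (simp add: B_def u_def power_divide power2_eq_square flip: add_divide_distrib)
    also have "4 * (\<beta>^2 * (F x)^2 - \<alpha>^2 * (G x)^2)
        = 2 * (\<beta>^2 - \<alpha>^2) * D x + 2 * (\<alpha>^2 + \<beta>^2) * ((F x)^2 - (G x)^2)"
      unfolding D_def by algebra
    finally show ?thesis
      using D0[of x] by (simp add: \<kappa>_def add_divide_distrib)
  qed
  have "solves_breather_equation \<alpha> \<beta> B"
    by (rule solves_breather_equation_if_system[OF dB du d\<kappa> d\<sigma> unit energy])
  then show ?thesis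
    by (simp add: breather)
qed

lemma solves_breather_equation_arctan:
  fixes \<alpha> \<beta> p q :: real
  assumes "\<alpha> \<noteq> 0"
  shows "solves_breather_equation \<alpha> \<beta>
    (\<lambda>x. 2 * deriv (\<lambda>z. arctan ((\<beta> / \<alpha>) * (sin (\<alpha> * (z + p)) / cosh (\<beta> * (z + q))))) x)"
proof -
  define F where "F = (\<lambda>z. \<alpha> * cosh (\<beta> * (z + q)))"
  define P where "P = (\<lambda>z. \<alpha> * \<beta> * sinh (\<beta> * (z + q)))"
  define G where "G = (\<lambda>z. \<beta> * sin (\<alpha> * (z + p)))"
  define Q where "Q = (\<lambda>z. \<alpha> * \<beta> * cos (\<alpha> * (z + p)))"
  have "solves_breather_equation \<alpha> \<beta> (\<lambda>x. 2 * deriv (\<lambda>z. arctan (G z / F z)) x)"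
  proof (rule solves_breather_equation_bilinear)
    fix x
    show "(F has_field_derivative P x) (at x)" "(G has_field_derivative Q x) (at x)"
      "(P has_field_derivative \<beta>^2 * F x) (at x)" "(Q has_field_derivative - (\<alpha>^2) * G x) (at x)"
      unfolding F_def G_def P_def Q_def
      by (auto intro!: derivative_eq_intros simp: power2_eq_square)
    \<comment> \<open>The weights \<open>\<alpha>\<close> in \<open>F\<close> and
      \<open>\<beta>\<close> in \<open>G\<close>, that is the amplitude
      \<open>\<beta> / \<alpha>\<close>, make the constants of the hyperbolic and circular
      Pythagorean identities cancel.\<close>
    have "(P x)^2 = \<beta>^2 * (F x)^2 - \<alpha>^2 * \<beta>^2"
      by (simp add: P_def F_def power_mult_distrib sinh_square_eq algebra_simps)
    moreover have "(Q x)^2 = \<alpha>^2 * \<beta>^2 - \<alpha>^2 * (G x)^2"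
      by (simp add: Q_def G_def power_mult_distrib cos_squared_eq algebra_simps)
    ultimately show "(P x)^2 + (Q x)^2 = \<beta>^2 * (F x)^2 - \<alpha>^2 * (G x)^2"
      by simp
    show "F x \<noteq> 0"
      using assms by (simp add: F_def)
  qed
  then show ?thesis
    by (simp add: F_def G_def)
qed

theorem theorem1p2:
  fixes \<alpha> \<beta> x1 x2 t :: real and i :: mkdv_order
  assumes "\<alpha> > 0" and "\<beta> > 0" and "i \<in> {Fifth, Seventh, Ninth}"
  shows "solves_breather_equation \<alpha> \<beta> (\<lambda>x. mkdv_breather i \<alpha> \<beta> x1 x2 t x)
       \<and> solves_breather_equation \<alpha> \<beta> (\<lambda>x. mkdv_breather Classical \<alpha> \<beta> x1 x2 t x)"
proof -
  \<comment> \<open>At fixed \<open>t\<close> the order only changes the two phase shifts, so an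
    arbitrary \<open>j\<close> covers both conjuncts.\<close>
  have "solves_breather_equation \<alpha> \<beta> (\<lambda>x. mkdv_breather j \<alpha> \<beta> x1 x2 t x)" for j
    using solves_breather_equation_arctan[of \<alpha> \<beta> "mkdv_delta j \<alpha> \<beta> * t + x1" "mkdv_gamma j \<alpha> \<beta> * t + x2"]
      assms(1)
    unfolding mkdv_breather_def by (simp add: add.assoc)
  then show ?thesis
    by simp
qed

end
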